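(* Let $0<\alpha<1$, $\kappa>0$, $\epsilon>0$, put $\beta:=1-\alpha$, and let $0=t_0<t_1<\cdots<t_N=T$ be a time mesh with step sizes $\tau_k=t_k-t_{k-1}$ and step ratios $r_k=\tau_k/\tau_{k-1}$ $(2\le k\le N)$ satisfying $$r_{k+1}\ \ge\ r_*(r_k):=\left[\frac{(2^\beta-1)\rho(r_k)}{\rho(2r_k)-\rho(r_k)}\right]^{\frac1{1-\beta}}\quad\text{for } 2\le k\le N-1,\qquad \rho(z):=(z+1)^{1+\beta}-z^{1+\beta}-1 .$$ Let $\phi^0,\phi^1,\dots,\phi^N$ be (sufficiently smooth, real-valued, $\Omega$-periodic) functions satisfying the variable-step Crank-Nicolson scheme for the time-fractional Allen-Cahn model $$\sum_{k=1}^{n}a_{n-k}^{(1-\alpha,n)}(\phi^k-\phi^{k-1})=-\kappa\mu^{n-\frac12},\qquad \mu^{n-\frac12}=f(\phi)^{n-\frac12}-\epsilon^2\Delta\phi^{n-\frac12},\qquad 1\le n\le N .$$ Then the scheme is energy stable in the sense that it preserves the following discrete energy dissipation law: for every $1\le n\le N$, $$\frac{E_\alpha[\phi^n]-E_\alpha[\phi^{n-1}]}{\tau_n}+\frac{1}{2\kappa\tau_n}\sum_{j=1}^{n-1}\left(\frac{1}{{}^{r}\mathsf p_{n-j}^{(1-\alpha,n)}}-\frac{1}{{}^{r}\mathsf p_{n-j-1}^{(1-\alpha,n)}}\right)\left\|\sum_{k=1}^{j}{}^{r}\mathsf p_{n-k}^{(1-\alpha,n)}(v^k-v^{k-1})\right\|^2=0,$$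 where $v^0:=0$, $v^j:=\sum_{\ell=1}^{j}\mathsf a_{j-\ell}^{(1-\alpha,j)}(\phi^\ell-\phi^{\ell-1})$ for $j\ge1$, and $$E_\alpha[\phi^n]:=E[\phi^n]+\frac{1}{2\kappa}\sum_{j=1}^n\mathsf p_{n-j}^{(1-\alpha,n)}\|v^j\|^2,\qquad E[\phi]:=\int_\Omega\left(\frac{\epsilon^2}{2}|\nabla\phi|^2+\frac14(\phi^2-1)^2\right)d\mathbf x .$$
   Context: $\Omega\subseteq\mathbb R^2$ is a periodic cell (periodic boundary conditions), $\langle\cdot,\cdot\rangle$ and $\|\cdot\|$ are the $L^2(\Omega)$ inner product and norm. $\phi^{n-\frac12}:=(\phi^n+\phi^{n-1})/2$, and $$f(\phi)^{n-\frac12}:=\tfrac12\left[(\phi^n)^2+(\phi^{n-1})^2\right]\phi^{n-\frac12}-\phi^{n-\frac12}.$$ $\omega_\beta(t):=t^{\beta-1}/\Gamma(\beta)$ for $t>0$, and for $\beta=1-\alpha$ and $1\le k\le n\le N$, $$a_{n-k}^{(\beta,n)}:=\frac{1}{\tau_n\tau_{k}}\int_{t_{n-1}}^{t_n}\int_{t_{k-1}}^{\min\{t,t_k\}}\omega_{\beta}(t-s)\,ds\,dt .$$ The modified kernels are $\mathsf a_{0}^{(\beta,n)}:=2a_{0}^{(\beta,n)}$ and $\mathsf a_{n-j}^{(\beta,n)}:=a_{n-j}^{(\beta,n)}$ for $1\le j\le n-1$. For any triangular array $\{a_{n-k}^{(n)}\}_{1\le k\le n}$ with $a_0^{(n)}\ne0$,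 the discrete orthogonal convolution (DOC) kernels are $\theta_0^{(n)}:=1/a_0^{(n)}$ and $\theta_{n-k}^{(n)}:=-\frac{1}{a_0^{(k)}}\sum_{j=k+1}^n\theta_{n-j}^{(n)}a_{j-k}^{(j)}$ for $1\le k\le n-1$; the DCC kernels are $p_{n-k}^{(n)}:=\sum_{j=k}^n\theta_{j-k}^{(j)}$ and the RCC kernels are ${}^{r}p_{n-k}^{(n)}:=\sum_{j=k}^n\theta_{n-j}^{(n)}$, for $1\le k\le n$. The kernels $\mathsf p_{n-k}^{(\beta,n)}$ and ${}^{r}\mathsf p_{n-k}^{(\beta,n)}$ are the DCC and RCC kernels of the modified array $\mathsf a_{n-k}^{(\beta,n)}$. Empty sums are zero, so $E_\alpha[\phi^0]=E[\phi^0]$. *)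

theory Defs
  imports "HOL-Analysis.Analysis"
begin

section \<open>Convolution kernels on a variable time mesh\<close>

text \<open>
  The mesh is a sequence \<open>t\<close> of time levels. A triangular array of kernels with entries
  \<open>a\<^sub>n\<^sub>-\<^sub>k\<close> at level \<open>n\<close>, for \<open>1 \<le> k \<le> n\<close>, is a function \<open>a :: nat \<Rightarrow> nat \<Rightarrow> real\<close> whose value
  \<open>a n k\<close> is the kernel with lower index \<open>n - k\<close> and upper index \<open>n\<close>: the second argument is
  \<open>k\<close>, not \<open>n - k\<close>. So the lower index 0 is \<open>a n n\<close>, and lower index \<open>n - j - 1\<close> is
  \<open>a n (j + 1)\<close>.
\<close>

definition step :: "(nat \<Rightarrow> real) \<Rightarrow> nat \<Rightarrow> real" where
  "step t k = t k - t (k - 1)"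

definition step_ratio :: "(nat \<Rightarrow> real) \<Rightarrow> nat \<Rightarrow> real" where
  "step_ratio t k = step t k / step t (k - 1)"

definition rho :: "real \<Rightarrow> real \<Rightarrow> real" where
  "rho \<beta> z = (z + 1) powr (1 + \<beta>) - z powr (1 + \<beta>) - 1"

definition ratio_bound :: "real \<Rightarrow> real \<Rightarrow> real" where
  "ratio_bound \<beta> z =
     ((2 powr \<beta> - 1) * rho \<beta> z / (rho \<beta> (2 * z) - rho \<beta> z)) powr (1 / (1 - \<beta>))"

text \<open>
  Only positive arguments are meant. At 0 the value is 0, which affects a null set in the
  double integral below.
\<close>

definition omega :: "real \<Rightarrow> real \<Rightarrow> real" where
  "omega \<beta> t = t powr (\<beta> - 1) / Gamma \<beta>"

definition kernel :: "real \<Rightarrow> (nat \<Rightarrow> real) \<Rightarrow> nat \<Rightarrow> nat \<Rightarrow> real" where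
  "kernel \<beta> t n k =
     1 / (step t n * step t k) *
     (LBINT r:{t (n - 1)..t n}. (LBINT s:{t (k - 1)..min r (t k)}. omega \<beta> (r - s)))"

definition mod_kernel :: "real \<Rightarrow> (nat \<Rightarrow> real) \<Rightarrow> nat \<Rightarrow> nat \<Rightarrow> real" where
  "mod_kernel \<beta> t n k = (if k = n then 2 * kernel \<beta> t n n else kernel \<beta> t n k)"

function doc :: "(nat \<Rightarrow> nat \<Rightarrow> real) \<Rightarrow> nat \<Rightarrow> nat \<Rightarrow> real" where
  "doc a n k =
     (if n \<le> k then 1 / a n n
      else - (1 / a k k) * (\<Sum>j = k + 1..n. doc a n j * a j k))"
  by pat_completeness auto
termination
  by (relation "Wellfounded.measure (\<lambda>(a, n, k). n - k)") auto

declare doc.simps [simp del]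

definition dcc :: "(nat \<Rightarrow> nat \<Rightarrow> real) \<Rightarrow> nat \<Rightarrow> nat \<Rightarrow> real" where
  "dcc a n k = (\<Sum>j = k..n. doc a j k)"

definition rcc :: "(nat \<Rightarrow> nat \<Rightarrow> real) \<Rightarrow> nat \<Rightarrow> nat \<Rightarrow> real" where
  "rcc a n k = (\<Sum>j = k..n. doc a n j)"

section \<open>Periodic functions on the plane\<close>

definition cell :: "real^2 \<Rightarrow> real^2 \<Rightarrow> real^2 \<Rightarrow> (real^2) set" where
  "cell c p q = {c + r *\<^sub>R p + s *\<^sub>R q | r s. r \<in> {0..1} \<and> s \<in> {0..1}}"

definition periodic :: "real^2 \<Rightarrow> real^2 \<Rightarrow> (real^2 \<Rightarrow> real) \<Rightarrow> bool" where
  "periodic p q u \<longleftrightarrow> (\<forall>x. u (x + p) = u x \<and> u (x + q) = u x)"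

definition partial :: "2 \<Rightarrow> (real^2 \<Rightarrow> real) \<Rightarrow> real^2 \<Rightarrow> real" where
  "partial i u x = frechet_derivative u (at x) (axis i 1)"

definition C2 :: "(real^2 \<Rightarrow> real) \<Rightarrow> bool" where
  "C2 u \<longleftrightarrow>
     u differentiable_on UNIV \<and>
     (\<forall>i. partial i u differentiable_on UNIV) \<and>
     (\<forall>i j. continuous_on UNIV (partial j (partial i u)))"

definition grad :: "(real^2 \<Rightarrow> real) \<Rightarrow> real^2 \<Rightarrow> real^2" where
  "grad u x = (\<chi> i. partial i u x)"

definition laplacian :: "(real^2 \<Rightarrow> real) \<Rightarrow> real^2 \<Rightarrow> real" where
  "laplacian u x = (\<Sum>i\<in>UNIV. partial i (partial i u) x)"

definition L2_norm_on :: "(real^2) set \<Rightarrow> (real^2 \<Rightarrow> real) \<Rightarrow> real" where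
  "L2_norm_on \<Omega> u = sqrt (LBINT x:\<Omega>. (u x)\<^sup>2)"

section \<open>The Crank-Nicolson scheme and its energies\<close>

definition midpoint_val :: "(nat \<Rightarrow> real^2 \<Rightarrow> real) \<Rightarrow> nat \<Rightarrow> real^2 \<Rightarrow> real" where
  "midpoint_val \<phi> n x = (\<phi> n x + \<phi> (n - 1) x) / 2"

definition f_mid :: "(nat \<Rightarrow> real^2 \<Rightarrow> real) \<Rightarrow> nat \<Rightarrow> real^2 \<Rightarrow> real" where
  "f_mid \<phi> n x =
     1 / 2 * ((\<phi> n x)\<^sup>2 + (\<phi> (n - 1) x)\<^sup>2) * midpoint_val \<phi> n x - midpoint_val \<phi> n x"

definition mu_mid :: "real \<Rightarrow> (nat \<Rightarrow> real^2 \<Rightarrow> real) \<Rightarrow> nat \<Rightarrow> real^2 \<Rightarrow> real" where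
  "mu_mid \<epsilon> \<phi> n x = f_mid \<phi> n x - \<epsilon>\<^sup>2 * laplacian (midpoint_val \<phi> n) x"

definition CN_scheme ::
  "(real^2) set \<Rightarrow> real \<Rightarrow> real \<Rightarrow> real \<Rightarrow> (nat \<Rightarrow> real) \<Rightarrow> nat \<Rightarrow> (nat \<Rightarrow> real^2 \<Rightarrow> real) \<Rightarrow> bool"
where
  "CN_scheme \<Omega> \<kappa> \<epsilon> \<alpha> t N \<phi> \<longleftrightarrow>
     (\<forall>n\<in>{1..N}. \<forall>x\<in>\<Omega>.
        (\<Sum>k = 1..n. kernel (1 - \<alpha>) t n k * (\<phi> k x - \<phi> (k - 1) x)) = - \<kappa> * mu_mid \<epsilon> \<phi> n x)"

text \<open>At \<open>j = 0\<close> the sum is empty, which gives the convention \<open>v\<^sup>0 = 0\<close>.\<close>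

definition v_seq ::
  "real \<Rightarrow> (nat \<Rightarrow> real) \<Rightarrow> (nat \<Rightarrow> real^2 \<Rightarrow> real) \<Rightarrow> nat \<Rightarrow> real^2 \<Rightarrow> real" where
  "v_seq \<alpha> t \<phi> j x = (\<Sum>l = 1..j. mod_kernel (1 - \<alpha>) t j l * (\<phi> l x - \<phi> (l - 1) x))"

definition energy :: "(real^2) set \<Rightarrow> real \<Rightarrow> (real^2 \<Rightarrow> real) \<Rightarrow> real" where
  "energy \<Omega> \<epsilon> u =
     (LBINT x:\<Omega>. \<epsilon>\<^sup>2 / 2 * (norm (grad u x))\<^sup>2 + 1 / 4 * ((u x)\<^sup>2 - 1)\<^sup>2)"

definition mod_energy ::
  "(real^2) set \<Rightarrow> real \<Rightarrow> real \<Rightarrow> real \<Rightarrow> (nat \<Rightarrow> real) \<Rightarrow> (nat \<Rightarrow> real^2 \<Rightarrow> real) \<Rightarrow> nat \<Rightarrow> real"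
where
  "mod_energy \<Omega> \<kappa> \<epsilon> \<alpha> t \<phi> n =
     energy \<Omega> \<epsilon> (\<phi> n) +
     1 / (2 * \<kappa>) *
       (\<Sum>j = 1..n. dcc (mod_kernel (1 - \<alpha>) t) n j * (L2_norm_on \<Omega> (v_seq \<alpha> t \<phi> j))\<^sup>2)"

end

theory Submission
  imports Defs
begin

text \<open>
  Fix \<open>n\<close> and let \<open>a\<close> be the modified kernels. Multiply the scheme by the increment
  \<open>d = \<phi>\<^sup>n - \<phi>\<^sup>n\<^sup>-\<^sup>1\<close> and integrate over the cell. The right-hand side becomes \<open>- \<kappa>\<close> times the increment
  of the energy \<open>E\<close> (\<open>energy_difference\<close>): the discrete nonlinearity is an exact difference
  quotient of the double-well potential, and the Laplacian is integrated by parts.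

  On the left-hand side, doubling the diagonal kernel makes the scheme read \<open>v\<^sup>n - a n n / 2 * d\<close>,
  and the DOC kernels, as the inverse of the triangular matrix \<open>a\<close>, express \<open>d\<close> through
  \<open>v\<^sup>1, \<dots>, v\<^sup>n\<close>. So \<open>2 v\<^sup>n d - a n n d\<^sup>2\<close> is a quadratic form in the \<open>v\<^sup>j\<close>. It equals the
  sum of \<open>doc a n j (v\<^sup>j)\<^sup>2\<close>, which is the increment of the DCC part of the modified energy
  (\<open>dcc_step\<close>), plus the weighted sum of squares in the dissipation law. This algebraic identity
  (\<open>rcc_square_identity\<close>) holds pointwise and comes from summation by parts, as the increments of the
  partial sums of \<open>rcc a n k (v\<^sup>k - v\<^sup>k\<^sup>-\<^sup>1)\<close> carry the RCC kernels by which one divides.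

  The division needs the RCC kernels to be nonzero. They are positive (\<open>rcc_pos\<close>) because
  they satisfy a recurrence with the decrements \<open>a (j - 1) k - a j k\<close> as coefficients, and each
  column of \<open>a\<close> is strictly decreasing (\<open>mod_kernel_strict_decreasing\<close>) by the concavity
  of \<open>\<lambda>x. x powr \<beta>\<close>.

  Integration by parts on the parallelogram reduces to the vanishing of the integral of a
  partial derivative of a periodic function (\<open>cell_integral_partial_eq_0\<close>). That integral is the
  derivative of a translated cell integral, which is constant in the translation.
\<close>

section \<open>Orthogonal and complementary kernels of a triangular array\<close>

text \<open>
  The recursion that defines \<open>doc a n k\<close> is exactly this equation for \<open>k < n\<close>, solved for
  its leading term: row \<open>n\<close> of the DOC kernels is row \<open>n\<close> of the inverse of the triangular
  matrix \<open>a\<close>.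
\<close>

lemma doc_orthogonality:
  assumes "\<And>k. k \<in> {1..n} \<Longrightarrow> a k k \<noteq> 0" "1 \<le> k" "k \<le> n"
  shows "(\<Sum>j = k..n. doc a n j * a j k) = (if k = n then 1 else 0)"
proof (cases "k = n")
  case True
  have "doc a n n = 1 / a n n"
    by (simp add: doc.simps)
  with True assms show ?thesis by simp
next
  case False
  then have "k < n" using assms by simp
  have "doc a n k = - (1 / a k k) * (\<Sum>j = k + 1..n. doc a n j * a j k)"
    using \<open>k < n\<close> by (subst doc.simps) simp
  then have "doc a n k * a k k = - (\<Sum>j = k + 1..n. doc a n j * a j k)"
    using assms by simp
  moreover have "(\<Sum>j = k..n. doc a n j * a j k) = doc a n k * a k k + (\<Sum>j = k + 1..n. doc a n j * a j k)"
    using \<open>k < n\<close> by (simp add: sum.atLeast_Suc_atMost)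
  ultimately show ?thesis using False by simp
qed

lemma doc_inversion:
  fixes d :: "nat \<Rightarrow> real"
  assumes "\<And>k. k \<in> {1..n} \<Longrightarrow> a k k \<noteq> 0" "1 \<le> n"
  shows "(\<Sum>j = 1..n. doc a n j * (\<Sum>l = 1..j. a j l * d l)) = d n"
proof -
  have "(\<Sum>j = 1..n. doc a n j * (\<Sum>l = 1..j. a j l * d l))
      = (\<Sum>j\<in>{1..n}. \<Sum>l | l \<in> {1..n} \<and> l \<le> j. doc a n j * a j l * d l)"
    by (intro sum.cong refl) (auto simp: sum_distrib_left mult.assoc intro!: sum.cong)
  also have "\<dots> = (\<Sum>l\<in>{1..n}. \<Sum>j | j \<in> {1..n} \<and> l \<le> j. doc a n j * a j l * d l)"
    by (rule sum.swap_restrict) auto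
  also have "\<dots> = (\<Sum>l = 1..n. d l * (\<Sum>j = l..n. doc a n j * a j l))"
    by (intro sum.cong refl) (auto simp: sum_distrib_left mult.commute mult.left_commute intro!: sum.cong)
  also have "\<dots> = (\<Sum>l = 1..n. d l * (if l = n then 1 else 0))"
    using assms by (intro sum.cong refl arg_cong2[where f="(*)"] doc_orthogonality) auto
  also have "\<dots> = d n"
    using assms by (simp add: if_distrib cong: if_cong)
  finally show ?thesis .
qed

lemma rcc_Suc:
  assumes "k \<le> n"
  shows "rcc a n k = doc a n k + rcc a n (Suc k)"
  unfolding rcc_def using assms by (simp add: sum.atLeast_Suc_atMost)

lemma summation_by_parts:
  fixes R b :: "nat \<Rightarrow> real"
  assumes "k \<le> m"
  shows "(\<Sum>j = k..m. (R j - R (Suc j)) * b j)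
       = R k * b k - (\<Sum>j = Suc k..m. R j * (b (j - 1) - b j)) - R (Suc m) * b m"
  using assms
  by (induction m rule: dec_induct) (simp_all add: algebra_simps)

text \<open>
  Since \<open>doc a n j\<close> is the difference of two consecutive RCC kernels, summing the
  orthogonality relation by parts moves the difference onto column \<open>k\<close> of \<open>a\<close>. The RCC kernels
  then satisfy a recurrence whose coefficients are the decrements of that column.
\<close>

lemma rcc_recurrence:
  assumes "\<And>k. k \<in> {1..n} \<Longrightarrow> a k k \<noteq> 0" "1 \<le> k" "k < n"
  shows "rcc a n k * a k k = (\<Sum>j = Suc k..n. rcc a n j * (a (j - 1) k - a j k))"
proof -
  have "0 = (\<Sum>j = k..n. doc a n j * a j k)"
    using doc_orthogonality[of n a k] assms by simp
  also have "\<dots> = (\<Sum>j = k..n. (rcc a n j - rcc a n (Suc j)) * a j k)"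
    by (intro sum.cong refl) (simp add: rcc_Suc)
  also have "\<dots> = rcc a n k * a k k - (\<Sum>j = Suc k..n. rcc a n j * (a (j - 1) k - a j k))"
    using assms by (subst summation_by_parts) (auto simp: rcc_def)
  finally show ?thesis by simp
qed

text \<open>
  With positive diagonal and strictly decreasing columns, all coefficients in
  the recurrence above are positive, so positivity propagates from the starting value
  \<open>1 / a n n\<close> at \<open>k = n\<close> down to \<open>k = 1\<close>.
\<close>

lemma rcc_pos:
  assumes diag: "\<And>k. k \<in> {1..n} \<Longrightarrow> a k k > 0"
    and decr: "\<And>j k. 1 \<le> k \<Longrightarrow> k < j \<Longrightarrow> j \<le> n \<Longrightarrow> a j k < a (j - 1) k"
    and "1 \<le> k" "k \<le> n"
  shows "rcc a n k > 0"
  using \<open>k \<le> n\<close> \<open>1 \<le> k\<close>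
proof (induction "n - k" arbitrary: k rule: less_induct)
  case less
  have nz: "a i i \<noteq> 0" if "i \<in> {1..n}" for i
    using diag[OF that] by simp
  show ?case
  proof (cases "k = n")
    case True
    then show ?thesis
      using diag[of n] less.prems by (simp add: rcc_def doc.simps)
  next
    case False
    then have "k < n" using less.prems by simp
    have "0 < (\<Sum>j = Suc k..n. rcc a n j * (a (j - 1) k - a j k))"
    proof (rule sum_pos)
      fix j assume j: "j \<in> {Suc k..n}"
      then have "0 < rcc a n j"
        using less.prems by (intro less.hyps) auto
      moreover have "a j k < a (j - 1) k"
        using decr j less.prems by auto
      ultimately show "0 < rcc a n j * (a (j - 1) k - a j k)" by simp
    qed (use \<open>k < n\<close> in auto)
    also have "\<dots> = rcc a n k * a k k"
      using rcc_recurrence[of n a k] nz less.prems \<open>k < n\<close> by simp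
    finally show ?thesis
      using diag[of k] less.prems by (simp add: zero_less_mult_iff)
  qed
qed

text \<open>
  After summation by parts the sum of \<open>(1 / R j - 1 / R (j + 1)) (S j)\<^sup>2\<close> consists of the terms
  \<open>((S j)\<^sup>2 - (S (j - 1))\<^sup>2) / R j\<close>. The factor \<open>S j - S (j - 1)\<close> contains \<open>R j\<close>, so the division
  cancels (this is where \<open>R j \<noteq> 0\<close> matters), and what remains telescopes to \<open>2 v S\<close> up to squares
  of \<open>v\<close>. The boundary terms \<open>(S m)\<^sup>2 / R m\<close> and \<open>R (m + 1) (v m)\<^sup>2\<close> are kept so that the
  identity can be proved by induction on \<open>m\<close>.
\<close>

lemma telescoped_square_identity:
  fixes R v S :: "nat \<Rightarrow> real"
  assumes R: "\<And>j. j \<in> {1..m} \<Longrightarrow> R j \<noteq> 0"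
    and S0: "S 0 = 0" and v0: "v 0 = 0"
    and S: "\<And>j. S (Suc j) = S j + R (Suc j) * (v (Suc j) - v j)"
  shows "(\<Sum>j = 1..m. (R j - R (Suc j)) * (v j)\<^sup>2)
       + (\<Sum>j = 1..m - 1. (1 / R j - 1 / R (Suc j)) * (S j)\<^sup>2) + (if m = 0 then 0 else (S m)\<^sup>2 / R m)
       = 2 * v m * S m - R (Suc m) * (v m)\<^sup>2"
  using R
proof (induction m)
  case 0
  then show ?case by (simp add: v0)
next
  case (Suc m)
  have Rm: "R (Suc m) \<noteq> 0" using Suc.prems by simp
  have inc: "(S (Suc m))\<^sup>2 / R (Suc m) - (S m)\<^sup>2 / R (Suc m)
      = (v (Suc m) - v m) * (2 * S (Suc m) - R (Suc m) * (v (Suc m) - v m))"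
    unfolding S[of m] using Rm by (simp add: field_simps power2_eq_square)
  have split: "(\<Sum>j = 1..Suc m - 1. (1 / R j - 1 / R (Suc j)) * (S j)\<^sup>2)
      = (\<Sum>j = 1..m - 1. (1 / R j - 1 / R (Suc j)) * (S j)\<^sup>2)
        + (if m = 0 then 0 else (S m)\<^sup>2 / R m) - (S m)\<^sup>2 / R (Suc m)"
    using S0 by (cases m) (auto simp: algebra_simps)
  have IH: "(\<Sum>j = 1..m. (R j - R (Suc j)) * (v j)\<^sup>2)
       + (\<Sum>j = 1..m - 1. (1 / R j - 1 / R (Suc j)) * (S j)\<^sup>2) + (if m = 0 then 0 else (S m)\<^sup>2 / R m)
       = 2 * v m * S m - R (Suc m) * (v m)\<^sup>2"
    using Suc.prems by (intro Suc.IH) simp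
  show ?case
    using inc IH unfolding split by (simp add: S[of m] algebra_simps power2_eq_square)
qed

text \<open>
  The case \<open>m = n\<close>, \<open>R = rcc a n\<close> of the previous identity. Here \<open>R (n + 1)\<close> is an empty sum, the
  last partial sum \<open>S n\<close> is \<open>d\<close> by summation by parts, and \<open>1 / R n\<close> is \<open>a n n\<close>, which turns the
  boundary term into \<open>a n n * d\<^sup>2\<close>.
\<close>

lemma rcc_square_identity:
  fixes v :: "nat \<Rightarrow> real"
  assumes R: "\<And>j. j \<in> {1..n} \<Longrightarrow> rcc a n j \<noteq> 0" and "1 \<le> n" and v0: "v 0 = 0"
  defines "S \<equiv> \<lambda>j. \<Sum>k = 1..j. rcc a n k * (v k - v (k - 1))"
    and "d \<equiv> \<Sum>j = 1..n. doc a n j * v j"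
  shows "(\<Sum>j = 1..n. doc a n j * (v j)\<^sup>2)
       + (\<Sum>j = 1..n - 1. (1 / rcc a n j - 1 / rcc a n (j + 1)) * (S j)\<^sup>2)
       = 2 * v n * d - a n n * d\<^sup>2"
proof -
  have diff: "doc a n j = rcc a n j - rcc a n (Suc j)" if "j \<in> {1..n}" for j
    using rcc_Suc[of j n a] that by simp
  have last: "rcc a n (Suc n) = 0" "rcc a n n = 1 / a n n"
    by (simp_all add: rcc_def doc.simps)
  have d: "S n = d"
  proof -
    have "d = (\<Sum>j = 1..n. (rcc a n j - rcc a n (Suc j)) * v j)"
      unfolding d_def by (intro sum.cong refl) (simp add: diff)
    also have "\<dots> = rcc a n 1 * v 1 - (\<Sum>j = Suc 1..n. rcc a n j * (v (j - 1) - v j))"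
      using \<open>1 \<le> n\<close> by (subst summation_by_parts) (auto simp: last)
    also have "\<dots> = S n"
      unfolding S_def using \<open>1 \<le> n\<close> v0
      by (simp add: sum.atLeast_Suc_atMost minus_mult_right del: mult_minus_right flip: sum_negf)
    finally show ?thesis by simp
  qed
  have "(\<Sum>j = 1..n. doc a n j * (v j)\<^sup>2) = (\<Sum>j = 1..n. (rcc a n j - rcc a n (Suc j)) * (v j)\<^sup>2)"
    by (intro sum.cong refl) (simp add: diff)
  moreover have "S (Suc j) = S j + rcc a n (Suc j) * (v (Suc j) - v j)" for j
    by (simp add: S_def)
  moreover have "S 0 = 0" by (simp add: S_def)
  ultimately show ?thesis
    using telescoped_square_identity[of n "rcc a n" S v] R v0 \<open>1 \<le> n\<close> by (simp add: last d algebra_simps)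
qed

section \<open>Positivity and monotonicity of the modified kernels\<close>

text \<open>
  For \<open>\<beta> < 1\<close> and \<open>u = 0\<close> the integrand is singular at the left end, so the fundamental theorem is used
  in the form that asks for a derivative only in the open interval. Nonnegativity of the integrand
  carries the result over from the gauge integral to the Lebesgue integral.
\<close>

lemma LBINT_powr:
  fixes \<beta> u w :: real
  assumes "0 < \<beta>" "0 \<le> u" "u \<le> w"
  shows "(LBINT x:{u..w}. x powr (\<beta> - 1)) = (w powr \<beta> - u powr \<beta>) / \<beta>"
proof -
  have "((\<lambda>x::real. x powr (\<beta> - 1)) has_integral w powr \<beta> / \<beta> - u powr \<beta> / \<beta>) {u..w}"
  proof (rule fundamental_theorem_of_calculus_interior[where f="\<lambda>x::real. x powr \<beta> / \<beta>"])
    show "continuous_on {u..w} (\<lambda>x::real. x powr \<beta> / \<beta>)"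
      using assms by (intro continuous_intros continuous_on_powr') auto
    fix x assume "x \<in> {u<..<w}"
    then have "((\<lambda>x::real. x powr \<beta> / \<beta>) has_real_derivative x powr (\<beta> - 1)) (at x)"
      using assms by (auto intro!: derivative_eq_intros simp: field_simps powr_diff)
    then show "((\<lambda>x::real. x powr \<beta> / \<beta>) has_vector_derivative x powr (\<beta> - 1)) (at x)"
      by (simp add: has_real_derivative_iff_has_vector_derivative)
  qed fact
  then have int: "(\<lambda>x. x powr (\<beta> - 1)) integrable_on {u..w}"
    "integral {u..w} (\<lambda>x. x powr (\<beta> - 1)) = (w powr \<beta> - u powr \<beta>) / \<beta>"
    by (auto simp: integrable_on_def integral_unique diff_divide_distrib)
  have "(LBINT x:{u..w}. x powr (\<beta> - 1)) = (LINT x:{u..w}|lebesgue. x powr (\<beta> - 1))"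
    unfolding set_lebesgue_integral_def by (rule integral_completion[symmetric]) simp
  also have "\<dots> = integral {u..w} (\<lambda>x. x powr (\<beta> - 1))"
    using int by (intro set_lebesgue_integral_eq_integral(2) nonnegative_absolutely_integrable_1) auto
  finally show ?thesis using int by simp
qed

lemma LBINT_omega:
  assumes "0 < \<beta>" "a \<le> b" "b \<le> r"
  shows "(LBINT s:{a..b}. omega \<beta> (r - s)) = ((r - a) powr \<beta> - (r - b) powr \<beta>) / Gamma (\<beta> + 1)"
proof -
  have "(LBINT s:{a..b}. omega \<beta> (r - s)) = (LBINT x:{r - b..r - a}. x powr (\<beta> - 1)) / Gamma \<beta>"
    unfolding set_lebesgue_integral_def
    by (subst lborel_integral_real_affine[where c="-1" and t=r])
       (auto simp: omega_def simp flip: integral_divide_zero intro!: Bochner_Integration.integral_cong split: split_indicator)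
  also have "\<dots> = ((r - a) powr \<beta> - (r - b) powr \<beta>) / Gamma (\<beta> + 1)"
    using assms Gamma_plus1[of \<beta>] by (subst LBINT_powr) (auto simp: nonpos_Ints_def)
  finally show ?thesis .
qed

lemma LBINT_mean_value:
  fixes g :: "real \<Rightarrow> real"
  assumes "a < b" "continuous_on {a..b} g"
  obtains \<xi> where "a < \<xi>" "\<xi> < b" "(LBINT r:{a..b}. g r) = (b - a) * g \<xi>"
proof -
  define F where "F x = integral {a..x} g" for x
  have der: "(F has_real_derivative g x) (at x within {a..b})" if "x \<in> {a..b}" for x
    unfolding F_def using assms that by (intro integral_has_real_derivative) auto
  have "continuous_on {a..b} F"
    using der by (intro DERIV_continuous_on) auto
  moreover have "(F has_derivative (\<lambda>h. g x * h)) (at x)" if "a < x" "x < b" for x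
    using der[of x] that at_within_Icc_at[of a x b] by (simp add: has_field_derivative_def)
  ultimately obtain \<xi> where \<xi>: "a < \<xi>" "\<xi> < b" "F b - F a = g \<xi> * (b - a)"
    using \<open>a < b\<close> by (metis mvt[of a b F "\<lambda>x h. g x * h"])
  have "(LBINT r:{a..b}. g r) = F b - F a"
    unfolding F_def
    using set_borel_integral_eq_integral(2)[OF borel_integrable_atLeastAtMost'[OF assms(2)]] by simp
  with \<xi> show ?thesis by (intro that[of \<xi>]) auto
qed

text \<open>
  Strict concavity of the power function. The case \<open>x = 0\<close>, where the derivative blows up, is
  included; it is strict subadditivity.
\<close>

lemma powr_increment_strict_decreasing:
  fixes \<beta> \<tau> :: real
  assumes "0 < \<beta>" "\<beta> < 1" "0 < \<tau>" "0 \<le> x" "x < y"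
  shows "(y + \<tau>) powr \<beta> - y powr \<beta> < (x + \<tau>) powr \<beta> - x powr \<beta>"
proof (rule DERIV_neg_imp_decreasing_open[OF \<open>x < y\<close>])
  fix z assume z: "x < z" "z < y"
  have "((\<lambda>z. (z + \<tau>) powr \<beta> - z powr \<beta>) has_real_derivative
      \<beta> * (z + \<tau>) powr (\<beta> - 1) - \<beta> * z powr (\<beta> - 1)) (at z)"
    using z assms by (auto intro!: derivative_eq_intros simp: powr_diff field_simps)
  moreover have "(z + \<tau>) powr (\<beta> - 1) < z powr (\<beta> - 1)"
    using z assms by (intro powr_less_mono2_neg) auto
  ultimately show "\<exists>D. ((\<lambda>z. (z + \<tau>) powr \<beta> - z powr \<beta>) has_real_derivative D) (at z) \<and> D < 0"
    using \<open>0 < \<beta>\<close> by (intro exI conjI) auto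
next
  show "continuous_on {x..y} (\<lambda>z. (z + \<tau>) powr \<beta> - z powr \<beta>)"
    using assms by (intro continuous_intros continuous_on_powr') auto
qed

lemma kernel_diag:
  assumes "0 < \<beta>" "t (k - 1) < t k"
  shows "kernel \<beta> t k k = step t k powr (\<beta> - 1) / Gamma (\<beta> + 2)"
proof -
  let ?a = "t (k - 1)" and ?b = "t k"
  have \<tau>: "0 < step t k" "?b - ?a = step t k" using assms by (auto simp: step_def)
  have "(LBINT r:{?a..?b}. (LBINT s:{?a..min r ?b}. omega \<beta> (r - s)))
      = (LBINT r:{?a..?b}. (r - ?a) powr \<beta> / Gamma (\<beta> + 1))"
    using assms by (intro set_lebesgue_integral_cong) (auto simp: min_absorb1 LBINT_omega)
  also have "\<dots> = (LBINT x:{0..step t k}. x powr (\<beta> + 1 - 1)) / Gamma (\<beta> + 1)"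
    unfolding set_lebesgue_integral_def
    by (subst lborel_integral_real_affine[where c=1 and t="?a"])
       (auto simp: step_def simp flip: integral_divide_zero intro!: Bochner_Integration.integral_cong split: split_indicator)
  also have "\<dots> = step t k powr (\<beta> + 1) / Gamma (\<beta> + 2)"
    using assms \<tau> Gamma_plus1[of "\<beta> + 1"]
    by (subst LBINT_powr) (auto simp: add.assoc nonpos_Ints_def)
  finally show ?thesis
    unfolding kernel_def using \<tau> by (simp add: powr_add powr_diff field_simps power2_eq_square)
qed

text \<open>
  For \<open>k < j\<close> the inner integral runs over the whole \<open>k\<close>-th interval, and the outer one is an average of a
  continuous function, attained at an interior point. That the point is interior is what later
  makes the comparison of two neighbouring averages strict.
\<close>

lemma kernel_offdiag:
  assumes "0 < \<beta>" "t (k - 1) < t k" "t k \<le> t (j - 1)" "t (j - 1) < t j"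
  obtains \<xi> where "t (j - 1) < \<xi>" "\<xi> < t j"
    "kernel \<beta> t j k = ((\<xi> - t (k - 1)) powr \<beta> - (\<xi> - t k) powr \<beta>) / (step t k * Gamma (\<beta> + 1))"
proof -
  define g where "g r = ((r - t (k - 1)) powr \<beta> - (r - t k) powr \<beta>) / Gamma (\<beta> + 1)" for r
  have "continuous_on {t (j - 1)..t j} g"
    unfolding g_def using assms Gamma_real_pos[of "\<beta> + 1"] less_imp_neq[of 0 "Gamma (\<beta> + 1)"]
    by (intro continuous_on_divide continuous_on_diff continuous_on_powr' continuous_on_const continuous_on_id) auto
  then obtain \<xi> where \<xi>: "t (j - 1) < \<xi>" "\<xi> < t j"
    "(LBINT r:{t (j - 1)..t j}. g r) = (t j - t (j - 1)) * g \<xi>"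
    using LBINT_mean_value[OF assms(4)] by metis
  have "(LBINT r:{t (j - 1)..t j}. (LBINT s:{t (k - 1)..min r (t k)}. omega \<beta> (r - s)))
      = (LBINT r:{t (j - 1)..t j}. g r)"
    using assms by (intro set_lebesgue_integral_cong) (auto simp: min_absorb2 LBINT_omega g_def)
  then have "kernel \<beta> t j k = g \<xi> / step t k"
    unfolding kernel_def using \<xi> assms by (simp add: step_def)
  then show ?thesis
    using \<xi> by (intro that[of \<xi>]) (auto simp: g_def)
qed

lemma mod_kernel_diag_pos:
  assumes "0 < \<beta>" "t (k - 1) < t k"
  shows "0 < mod_kernel \<beta> t k k"
  using assms Gamma_real_pos[of "\<beta> + 2"] by (simp add: mod_kernel_def kernel_diag step_def)

text \<open>
  Each entry below the diagonal is an increment of the concave function \<open>\<lambda>x. x powr \<beta>\<close> over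
  length \<open>\<tau>\<^sub>k\<close>, evaluated at a point of the \<open>j\<close>-th interval; such increments decrease as the point
  moves to the right. The step from the diagonal to the first entry below it relies on the doubling
  of the diagonal: the increment is below its value \<open>\<tau>\<^sub>k powr \<beta>\<close> at 0, while the modified diagonal
  carries the factor \<open>2 / (\<beta> + 1) \<ge> 1\<close> in front of the corresponding quantity.
\<close>

lemma mod_kernel_strict_decreasing:
  assumes "0 < \<beta>" "\<beta> < 1"
    and mesh: "\<And>i. i \<in> {1..N} \<Longrightarrow> t (i - 1) < t i"
    and "1 \<le> k" "k < j" "j \<le> N"
  shows "mod_kernel \<beta> t j k < mod_kernel \<beta> t (j - 1) k"
proof -
  have mono: "t i \<le> t l" if "i \<le> l" "l \<le> N" for i l
    using that
  proof (induction l rule: dec_induct)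
    case (step l)
    then show ?case using mesh[of "Suc l"] by auto
  qed simp
  have \<tau>: "0 < step t k" "t (k - 1) < t k" using mesh[of k] assms by (auto simp: step_def)
  have G: "0 < Gamma (\<beta> + 1)" using assms by (intro Gamma_real_pos) simp
  define D where "D x = (x + step t k) powr \<beta> - x powr \<beta>" for x
  have D: "D y < D x" if "0 \<le> x" "x < y" for x y
    unfolding D_def using powr_increment_strict_decreasing assms \<tau> that by blast
  have off: "\<exists>\<xi>>t (i - 1). \<xi> < t i \<and> mod_kernel \<beta> t i k = D (\<xi> - t k) / (step t k * Gamma (\<beta> + 1))"
    if i: "k < i" "i \<le> N" for i
  proof -
    obtain \<xi> where "t (i - 1) < \<xi>" "\<xi> < t i"
      "kernel \<beta> t i k = ((\<xi> - t (k - 1)) powr \<beta> - (\<xi> - t k) powr \<beta>) / (step t k * Gamma (\<beta> + 1))"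
      using kernel_offdiag[of \<beta> t k i] assms \<tau> mono[of k "i - 1"] mesh[of i] i by auto
    then show ?thesis
      using i by (intro exI[of _ \<xi>]) (auto simp: mod_kernel_def D_def step_def)
  qed
  obtain \<xi> where \<xi>: "t (j - 1) < \<xi>" 
    and j: "mod_kernel \<beta> t j k = D (\<xi> - t k) / (step t k * Gamma (\<beta> + 1))"
    using off[of j] assms by blast
  show ?thesis
  proof (cases "k = j - 1")
    case True
    have "D (\<xi> - t k) < D 0"
      using \<xi> True by (intro D) auto
    also have "D 0 = step t k powr \<beta>" by (simp add: D_def)
    finally have "mod_kernel \<beta> t j k < step t k powr \<beta> / (step t k * Gamma (\<beta> + 1))"
      unfolding j using \<tau> G by (intro divide_strict_right_mono) auto
    also have "\<dots> \<le> 2 / (\<beta> + 1) * (step t k powr \<beta> / (step t k * Gamma (\<beta> + 1)))"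
      using mult_right_mono[of 1 "2 / (\<beta> + 1)" "step t k powr \<beta> / (step t k * Gamma (\<beta> + 1))"] assms \<tau> G
      by simp
    also have "\<dots> = mod_kernel \<beta> t k k"
      using assms \<tau> Gamma_plus1[of "\<beta> + 1"] G
      by (simp add: mod_kernel_def kernel_diag powr_diff add.assoc nonpos_Ints_def field_simps)
    finally show ?thesis using True by simp
  next
    case False
    then obtain \<eta> where \<eta>: "t (j - 1 - 1) < \<eta>" "\<eta> < t (j - 1)"
      and j1: "mod_kernel \<beta> t (j - 1) k = D (\<eta> - t k) / (step t k * Gamma (\<beta> + 1))"
      using off[of "j - 1"] assms by force
    have "t k \<le> t (j - 1 - 1)"
      using False assms by (intro mono) auto
    then have "D (\<xi> - t k) < D (\<eta> - t k)"
      using \<xi> \<eta> by (intro D) auto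
    then show ?thesis
      unfolding j j1 using \<tau> G by (intro divide_strict_right_mono) auto
  qed
qed

section \<open>Translation invariance of integrals over the cell\<close>

text \<open>
  The coefficient of \<open>p\<close> when \<open>x\<close> is expanded in the basis \<open>p, q\<close>, by Cramer's rule; the
  coefficient of \<open>q\<close> is \<open>coord q p x\<close>.
\<close>

definition coord :: "real^2 \<Rightarrow> real^2 \<Rightarrow> real^2 \<Rightarrow> real" where
  "coord p q x = (x$1 * q$2 - x$2 * q$1) / (p$1 * q$2 - p$2 * q$1)"

lemma independent_pair_det:
  fixes p q :: "real^2"
  assumes "p \<noteq> q" "independent {p, q}"
  shows "p$1 * q$2 - p$2 * q$1 \<noteq> 0"
proof
  assume det: "p$1 * q$2 - p$2 * q$1 = 0"
  have "p \<noteq> 0" using assms(2) dependent_zero by blast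
  then obtain r where "q = r *\<^sub>R p"
  proof (cases "p$1 = 0")
    case True
    then have "p$2 \<noteq> 0" using \<open>p \<noteq> 0\<close> by (auto simp: vec_eq_iff forall_2)
    then have "q = (q$2 / p$2) *\<^sub>R p" using det True by (auto simp: vec_eq_iff forall_2)
    then show ?thesis by (rule that)
  next
    case False
    then have "q = (q$1 / p$1) *\<^sub>R p" using det by (auto simp: vec_eq_iff forall_2 field_simps)
    then show ?thesis by (rule that)
  qed
  then have "q \<in> span ({p, q} - {q})"
    using \<open>p \<noteq> q\<close> by (simp add: insert_Diff_if span_mul span_base)
  then show False using assms(2) unfolding dependent_def by blast
qed

lemma coord_decomposition:
  assumes det: "p$1 * q$2 - p$2 * q$1 \<noteq> 0"
  shows "x = coord p q x *\<^sub>R p + coord q p x *\<^sub>R q"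
proof -
  let ?D = "p$1 * q$2 - p$2 * q$1"
  have swap: "coord q p x = (x$2 * p$1 - x$1 * p$2) / ?D"
    using det by (simp add: coord_def divide_simps) (simp add: algebra_simps)
  have "?D * x$i = (x$1 * q$2 - x$2 * q$1) * p$i + (x$2 * p$1 - x$1 * p$2) * q$i" for i
    using exhaust_2[of i] by (auto simp: algebra_simps)
  then have "((x$1 * q$2 - x$2 * q$1) * p$i + (x$2 * p$1 - x$1 * p$2) * q$i) / ?D = x$i" for i
    using det by (metis nonzero_mult_div_cancel_left)
  then have "(coord p q x *\<^sub>R p + coord q p x *\<^sub>R q) $ i = x $ i" for i
    unfolding swap by (simp add: coord_def add_divide_distrib)
  then show ?thesis
    by (simp only: vec_eq_iff simp_thms)
qed

text \<open>
  The cell with its first coordinate ranging over \<open>{a..b}\<close> in place of \<open>{0..1}\<close>: the pieces into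
  which a translate of the cell in the direction \<open>p\<close> is cut.
\<close>

definition strip :: "real^2 \<Rightarrow> real^2 \<Rightarrow> real^2 \<Rightarrow> real \<Rightarrow> real \<Rightarrow> (real^2) set" where
  "strip c p q a b = (\<lambda>(r, s). c + r *\<^sub>R p + s *\<^sub>R q) ` ({a..b} \<times> {0..1})"

lemma cell_eq_strip: "cell c p q = strip c p q 0 1"
  unfolding cell_def strip_def by force

lemma cell_commute: "cell c p q = cell c q p"
proof -
  have "cell c p q \<subseteq> cell c q p" for p q
    unfolding cell_def by (force simp: add_ac)
  then show ?thesis by blast
qed

lemma compact_strip: "compact (strip c p q a b)"
  unfolding strip_def case_prod_unfold
  by (intro compact_continuous_image compact_Times compact_Icc continuous_intros)

lemma compact_cell: "compact (cell c p q)"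
  by (simp add: cell_eq_strip compact_strip)

lemma mem_strip_iff:
  assumes det: "p$1 * q$2 - p$2 * q$1 \<noteq> 0"
  shows "x \<in> strip c p q a b \<longleftrightarrow> coord p q (x - c) \<in> {a..b} \<and> coord q p (x - c) \<in> {0..1}"
proof
  have det': "q$1 * p$2 - q$2 * p$1 \<noteq> 0" using det by (simp add: algebra_simps)
  assume "x \<in> strip c p q a b"
  then obtain r s where rs: "r \<in> {a..b}" "s \<in> {0..1}" "x = c + r *\<^sub>R p + s *\<^sub>R q"
    by (auto simp: strip_def)
  have "coord p q (x - c) = r" "coord q p (x - c) = s"
    unfolding coord_def rs(3) using det det' by (auto simp: field_simps)
  then show "coord p q (x - c) \<in> {a..b} \<and> coord q p (x - c) \<in> {0..1}" using rs by simp
next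
  assume *: "coord p q (x - c) \<in> {a..b} \<and> coord q p (x - c) \<in> {0..1}"
  have "x = c + coord p q (x - c) *\<^sub>R p + coord q p (x - c) *\<^sub>R q"
    using coord_decomposition[OF det, of "x - c"] by (simp add: algebra_simps)
  then show "x \<in> strip c p q a b"
    unfolding strip_def using * by (intro image_eqI[where x="(coord p q (x - c), coord q p (x - c))"]) auto
qed

lemma coord_add_scaleR:
  assumes det: "p$1 * q$2 - p$2 * q$1 \<noteq> 0"
  shows "coord p q (x + r *\<^sub>R p) = coord p q x + r" "coord q p (x + r *\<^sub>R p) = coord q p x"
proof -
  have det': "q$1 * p$2 - q$2 * p$1 \<noteq> 0" using det by (simp add: algebra_simps)
  show "coord p q (x + r *\<^sub>R p) = coord p q x + r" "coord q p (x + r *\<^sub>R p) = coord q p x"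
    unfolding coord_def using det det' by (auto simp: field_simps)
qed

text \<open>
  The edges along which strips are glued lie on lines, which are null sets.
\<close>

lemma AE_coord_neq:
  assumes det: "p$1 * q$2 - p$2 * q$1 \<noteq> 0"
  shows "AE x in lborel. coord p q (x - c) \<noteq> k"
proof -
  define w :: "real^2" where "w = (\<chi> i. if i = 1 then q$2 else - q$1)"
  have w: "w \<bullet> x = x$1 * q$2 - x$2 * q$1" for x
    by (simp add: w_def inner_vec_def sum_2)
  have "w \<noteq> 0"
    using w[of p] det by auto
  then have "negligible {x. w \<bullet> x = k * (p$1 * q$2 - p$2 * q$1) + w \<bullet> c}"
    by (intro negligible_hyperplane) auto
  moreover have "{x. w \<bullet> x = k * (p$1 * q$2 - p$2 * q$1) + w \<bullet> c} = {x. coord p q (x - c) = k}"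
    using det by (auto simp: coord_def w field_simps)
  ultimately have "AE x in lebesgue. coord p q (x - c) \<noteq> k"
    by (auto simp: negligible_iff_null_sets intro!: AE_I')
  then show ?thesis by (simp add: AE_completion_iff)
qed

lemma lborel_integral_translate:
  fixes f :: "'a::euclidean_space \<Rightarrow> real"
  assumes "f \<in> borel_measurable borel"
  shows "(\<integral>x. f (x + a) \<partial>lborel) = (\<integral>x. f x \<partial>lborel)"
proof -
  have "(\<integral>x. f x \<partial>lborel) = (\<integral>x. f x \<partial>distr lborel borel ((+) a))"
    by (simp add: lborel_distr_plus)
  also have "\<dots> = (\<integral>x. f (a + x) \<partial>lborel)"
    using assms by (subst integral_distr) auto
  finally show ?thesis by (simp add: add.commute)
qed

lemma strip_integrable:
  assumes "continuous_on UNIV (h :: real^2 \<Rightarrow> real)"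
  shows "integrable lborel (\<lambda>x. indicator (strip c p q a b) x * h x)"
  using borel_integrable_compact[OF compact_strip continuous_on_subset[OF assms]] by simp

lemma cell_set_integrable:
  assumes "continuous_on UNIV (h :: real^2 \<Rightarrow> real)"
  shows "set_integrable lborel (cell c p q) h"
  unfolding set_integrable_def cell_eq_strip using strip_integrable[OF assms] by simp

lemma strip_integral_split:
  assumes det: "p$1 * q$2 - p$2 * q$1 \<noteq> 0"
    and cont: "continuous_on UNIV (h :: real^2 \<Rightarrow> real)" and "a \<le> m" "m \<le> b"
  shows "(LBINT x:strip c p q a b. h x) = (LBINT x:strip c p q a m. h x) + (LBINT x:strip c p q m b. h x)"
proof -
  note I = strip_integrable[OF cont]
  have "(LBINT x:strip c p q a b. h x)
      = (\<integral>x. indicator (strip c p q a m) x * h x + indicator (strip c p q m b) x * h x \<partial>lborel)"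
    unfolding set_lebesgue_integral_def
  proof (rule integral_cong_AE)
    show "AE x in lborel. indicator (strip c p q a b) x *\<^sub>R h x =
        indicator (strip c p q a m) x * h x + indicator (strip c p q m b) x * h x"
      using AE_coord_neq[OF det, of c m]
      by eventually_elim (use assms in \<open>auto simp: indicator_def mem_strip_iff[OF det]\<close>)
  qed (use I[of c p q a b] I[of c p q a m] I[of c p q m b] in auto)
  also have "\<dots> = (LBINT x:strip c p q a m. h x) + (LBINT x:strip c p q m b. h x)"
    using I by (simp add: set_lebesgue_integral_def)
  finally show ?thesis .
qed

lemma strip_integral_translate:
  assumes det: "p$1 * q$2 - p$2 * q$1 \<noteq> 0"
    and cont: "continuous_on UNIV (h :: real^2 \<Rightarrow> real)"
  shows "(LBINT x:strip c p q a b. h (x + r *\<^sub>R p)) = (LBINT x:strip c p q (a + r) (b + r). h x)"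
proof -
  have shift: "x + r *\<^sub>R p \<in> strip c p q (a + r) (b + r) \<longleftrightarrow> x \<in> strip c p q a b" for x
    using coord_add_scaleR[OF det, of "x - c" r]
    by (simp add: mem_strip_iff[OF det] algebra_simps)
  have "(LBINT x:strip c p q a b. h (x + r *\<^sub>R p))
      = (\<integral>x. (\<lambda>x. indicator (strip c p q (a + r) (b + r)) x * h x) (x + r *\<^sub>R p) \<partial>lborel)"
    unfolding set_lebesgue_integral_def
    by (intro Bochner_Integration.integral_cong) (auto simp: indicator_def shift)
  also have "\<dots> = (LBINT x:strip c p q (a + r) (b + r). h x)"
    using strip_integrable[OF cont, of c p q "a + r" "b + r"]
    by (subst lborel_integral_translate) (auto simp: set_lebesgue_integral_def)
  finally show ?thesis .
qed

text \<open>
  The translate of the cell by \<open>r *\<^sub>R p\<close> sticks out of the cell in the strip \<open>{1..1 + r}\<close>, which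
  periodicity maps back to the strip \<open>{0..r}\<close> that the translate has left.
\<close>

lemma cell_integral_translate:
  assumes det: "p$1 * q$2 - p$2 * q$1 \<noteq> 0"
    and cont: "continuous_on UNIV (h :: real^2 \<Rightarrow> real)"
    and per: "\<And>x. h (x + p) = h x" and "0 \<le> r" "r \<le> 1"
  shows "(LBINT x:cell c p q. h (x + r *\<^sub>R p)) = (LBINT x:cell c p q. h x)"
proof -
  note split = strip_integral_split[OF det cont, of _ _ _ c]
  have "(LBINT x:cell c p q. h (x + r *\<^sub>R p)) = (LBINT x:strip c p q r (1 + r). h x)"
    unfolding cell_eq_strip by (subst strip_integral_translate[OF det cont]) simp
  also have "\<dots> = (LBINT x:strip c p q r 1. h x) + (LBINT x:strip c p q 1 (1 + r). h x)"
    using assms by (intro split) auto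
  also have "(LBINT x:strip c p q 1 (1 + r). h x) = (LBINT x:strip c p q 0 r. h (x + 1 *\<^sub>R p))"
    by (subst strip_integral_translate[OF det cont]) (simp add: add.commute)
  also have "\<dots> = (LBINT x:strip c p q 0 r. h x)"
    by (simp add: per)
  also have "(LBINT x:strip c p q r 1. h x) + (LBINT x:strip c p q 0 r. h x) = (LBINT x:cell c p q. h x)"
    unfolding cell_eq_strip using assms by (subst split[of 0 r 1]) auto
  finally show ?thesis .
qed

text \<open>
  All difference quotients of \<open>g\<close> in the direction \<open>p\<close> have integral 0 by translation invariance,
  and they converge to the derivative boundedly. This gives the divergence theorem on a
  parallelogram with periodic boundary values without parametrising its boundary.
\<close>

lemma cell_integral_directional_derivative:
  assumes det: "p$1 * q$2 - p$2 * q$1 \<noteq> 0"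
    and der: "\<And>x. (g has_derivative g' x) (at x)"
    and cont: "continuous_on UNIV (\<lambda>x. g' x p)"
    and per: "\<And>x. g (x + p) = g x"
  shows "(LBINT x:cell c p q. g' x p) = (0::real)"
proof -
  define e where "e n = inverse (real (Suc n))" for n
  have e: "0 < e n" "e n \<le> 1" for n by (auto simp: e_def field_simps)
  have line: "((\<lambda>r. g (x + r *\<^sub>R p)) has_real_derivative g' (x + r *\<^sub>R p) p) (at r)" for x r
  proof -
    have "((\<lambda>r. g (x + r *\<^sub>R p)) has_derivative (\<lambda>h. g' (x + r *\<^sub>R p) (h *\<^sub>R p))) (at r)"
      by (rule has_derivative_compose[OF _ der]) (auto intro!: derivative_eq_intros)
    moreover have "g' (x + r *\<^sub>R p) (h *\<^sub>R p) = g' (x + r *\<^sub>R p) p * h" for h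
      using has_derivative_linear[OF der] by (simp add: linear_cmul mult.commute)
    ultimately show ?thesis by (simp add: has_field_derivative_def)
  qed
  have gcont: "continuous_on UNIV g"
    using has_derivative_continuous[OF der] by (simp add: continuous_on_eq_continuous_at)
  have sum0: "(LBINT x:cell c p q. (g (x + e n *\<^sub>R p) - g x) / e n) = 0" for n
  proof -
    have "continuous_on UNIV (\<lambda>x. g (x + e n *\<^sub>R p))"
      by (intro continuous_on_compose2[OF gcont] continuous_intros) auto
    then have "(LBINT x:cell c p q. g (x + e n *\<^sub>R p) - g x)
        = (LBINT x:cell c p q. g (x + e n *\<^sub>R p)) - (LBINT x:cell c p q. g x)"
      by (intro set_integral_diff cell_set_integrable gcont)
    also have "\<dots> = 0"
      using cell_integral_translate[OF det gcont per, of "e n" c] e[of n] by simp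
    finally show ?thesis
      using e by simp
  qed
  \<comment> \<open>The mean value theorem evaluates the derivative at points x + z p with z < 1, which may leave the cell
    but stay in the strip of double length.\<close>
  obtain B where B: "\<And>x. x \<in> strip c p q 0 2 \<Longrightarrow> \<bar>g' x p\<bar> \<le> B"
  proof -
    have "bounded ((\<lambda>x. g' x p) ` strip c p q 0 2)"
      by (intro compact_imp_bounded compact_continuous_image compact_strip continuous_on_subset[OF cont]) auto
    then show ?thesis using that by (auto simp: bounded_iff)
  qed
  have "(\<lambda>n. LBINT x:cell c p q. (g (x + e n *\<^sub>R p) - g x) / e n) \<longlonglongrightarrow> (LBINT x:cell c p q. g' x p)"
    unfolding set_lebesgue_integral_def
  proof (rule integral_dominated_convergence)
    show "integrable lborel (\<lambda>x. indicator (cell c p q) x * B)"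
      using strip_integrable[of "\<lambda>_. B"] by (simp add: cell_eq_strip)
    show "(\<lambda>x. indicator (cell c p q) x *\<^sub>R g' x p) \<in> borel_measurable lborel"
      using cell_set_integrable[OF cont] unfolding set_integrable_def by auto
    show "(\<lambda>x. indicator (cell c p q) x *\<^sub>R ((g (x + e n *\<^sub>R p) - g x) / e n)) \<in> borel_measurable lborel" for n
    proof -
      have "continuous_on UNIV (\<lambda>x. (g (x + e n *\<^sub>R p) - g x) / e n)"
        using e(1)[of n] by (intro continuous_intros continuous_on_compose2[OF gcont] gcont) auto
      from cell_set_integrable[OF this] show ?thesis unfolding set_integrable_def by auto
    qed
    show "AE x in lborel. (\<lambda>n. indicator (cell c p q) x *\<^sub>R ((g (x + e n *\<^sub>R p) - g x) / e n))
        \<longlonglongrightarrow> indicator (cell c p q) x *\<^sub>R g' x p"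
    proof (intro AE_I2 tendsto_scaleR tendsto_const)
      fix x
      have "((\<lambda>h. (g (x + h *\<^sub>R p) - g x) / h) \<longlongrightarrow> g' x p) (at 0)"
        using line[of x 0] by (simp add: has_field_derivative_def has_derivative_at' DERIV_def flip: has_field_derivative_def)
      moreover have "filterlim e (at 0) sequentially"
        unfolding filterlim_at e_def using LIMSEQ_inverse_real_of_nat by (auto)
      ultimately show "(\<lambda>n. (g (x + e n *\<^sub>R p) - g x) / e n) \<longlonglongrightarrow> g' x p"
        by (rule filterlim_compose)
    qed
    show "AE x in lborel. norm (indicator (cell c p q) x *\<^sub>R ((g (x + e n *\<^sub>R p) - g x) / e n))
        \<le> indicator (cell c p q) x * B" for n
    proof (intro AE_I2)
      fix x
      show "norm (indicator (cell c p q) x *\<^sub>R ((g (x + e n *\<^sub>R p) - g x) / e n)) \<le> indicator (cell c p q) x * B"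
      proof (cases "x \<in> cell c p q")
        case True
        obtain z where z: "0 < z" "z < e n" "g (x + e n *\<^sub>R p) - g (x + 0 *\<^sub>R p) = (e n - 0) * g' (x + z *\<^sub>R p) p"
          using MVT2[OF e(1)[of n], of "\<lambda>r. g (x + r *\<^sub>R p)" "\<lambda>r. g' (x + r *\<^sub>R p) p"] line by blast
        have "x + z *\<^sub>R p \<in> strip c p q 0 2"
          using True z e(2)[of n] coord_add_scaleR[OF det, of "x - c" z]
          by (simp add: cell_eq_strip mem_strip_iff[OF det] algebra_simps)
        then show ?thesis
          using B z(3) e(1)[of n] True by simp
      qed simp
    qed
  qed
  then show ?thesis
    unfolding sum0 by (simp add: LIMSEQ_const_iff)
qed


section \<open>Partial derivatives and Green's identity for periodic functions\<close>

lemma has_derivative_partials: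
  assumes "(u has_derivative u') (at x)"
  shows "partial i u x = u' (axis i 1)" "u' h = (\<Sum>i\<in>UNIV. h $ i * partial i u x)"
proof -
  show part: "partial i u x = u' (axis i 1)" for i
    unfolding partial_def using frechet_derivative_at[OF assms] by simp
  have lin: "linear u'" using has_derivative_linear[OF assms] .
  have "u' h = u' (\<Sum>i\<in>UNIV. h $ i *\<^sub>R axis i 1)"
    using basis_expansion[of h] by (simp add: scalar_mult_eq_scaleR)
  also have "\<dots> = (\<Sum>i\<in>UNIV. h $ i * partial i u x)"
    by (simp add: linear_sum[OF lin] linear_cmul[OF lin] part)
  finally show "u' h = (\<Sum>i\<in>UNIV. h $ i * partial i u x)" .
qed

lemma differentiable_has_frechet:
  assumes "u differentiable_on UNIV"
  shows "(u has_derivative frechet_derivative u (at x)) (at x)"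
  using assms by (simp add: differentiable_on_def flip: frechet_derivative_works)

text \<open>
  A coordinate direction is a combination of the two periods \<open>p\<close> and \<open>q\<close>, and the derivative in the
  direction of either period integrates to 0.
\<close>

lemma cell_integral_partial_eq_0:
  assumes indep: "p \<noteq> q" "independent {p, q}"
    and diff: "g differentiable_on UNIV"
    and cont: "\<And>j. continuous_on UNIV (partial j g)"
    and per: "periodic p q g"
  shows "(LBINT x:cell c p q. partial i g x) = 0"
proof -
  have det: "p$1 * q$2 - p$2 * q$1 \<noteq> 0"
    using independent_pair_det[OF indep] .
  have det': "q$1 * p$2 - q$2 * p$1 \<noteq> 0" using det by (simp add: algebra_simps)
  let ?g' = "\<lambda>x. frechet_derivative g (at x)"
  note der = differentiable_has_frechet[OF diff]
  have dcont: "continuous_on UNIV (\<lambda>x. ?g' x h)" for h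
    by (subst has_derivative_partials(2)[OF der]) (intro continuous_intros cont)
  let ?a = "coord p q (axis i 1)" and ?b = "coord q p (axis i 1)"
  have "partial i g x = ?a * ?g' x p + ?b * ?g' x q" for x
  proof -
    have lin: "linear (?g' x)" using has_derivative_linear[OF der] .
    have "partial i g x = ?g' x (?a *\<^sub>R p + ?b *\<^sub>R q)"
      unfolding partial_def using coord_decomposition[OF det, of "axis i 1"] by simp
    then show ?thesis
      by (simp add: linear_add[OF lin] linear_cmul[OF lin])
  qed
  then have "(LBINT x:cell c p q. partial i g x)
      = ?a * (LBINT x:cell c p q. ?g' x p) + ?b * (LBINT x:cell c p q. ?g' x q)"
    by (simp add: set_integral_add cell_set_integrable dcont)
  also have "(LBINT x:cell c p q. ?g' x p) = 0"
    using per by (intro cell_integral_directional_derivative[OF det der dcont]) (simp add: periodic_def)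
  also have "(LBINT x:cell c p q. ?g' x q) = 0"
    unfolding cell_commute[of c p q] using per
    by (intro cell_integral_directional_derivative[OF det' der dcont]) (simp add: periodic_def)
  finally show ?thesis by simp
qed

lemma periodic_partial:
  assumes "u differentiable_on UNIV" "periodic p q u"
  shows "periodic p q (partial i u)"
proof -
  have "partial i u (x + a) = partial i u x" if a: "\<And>x. u (x + a) = u x" for x a
  proof -
    have "((\<lambda>y. u (y + a)) has_derivative frechet_derivative u (at (x + a))) (at x)"
      by (rule has_derivative_compose[OF _ differentiable_has_frechet[OF assms(1)], where f="\<lambda>y. y + a"])
         (auto intro!: derivative_eq_intros)
    then have "(u has_derivative frechet_derivative u (at (x + a))) (at x)"
      by (simp add: a)
    from has_derivative_partials(1)[OF this] show ?thesis
      by (simp add: partial_def)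
  qed
  then show ?thesis using assms(2) by (auto simp: periodic_def)
qed

lemma partial_linear_combination:
  assumes "u differentiable_on UNIV" "w differentiable_on UNIV"
  shows "partial i (\<lambda>x. a * u x + b * w x) = (\<lambda>x. a * partial i u x + b * partial i w x)"
proof
  fix x
  note d = differentiable_has_frechet[OF assms(1), of x] differentiable_has_frechet[OF assms(2), of x]
  have "((\<lambda>x. a * u x + b * w x) has_derivative
      (\<lambda>h. a * frechet_derivative u (at x) h + b * frechet_derivative w (at x) h)) (at x)"
    using d by (auto intro!: derivative_eq_intros)
  from has_derivative_partials(1)[OF this]
  show "partial i (\<lambda>x. a * u x + b * w x) x = a * partial i u x + b * partial i w x"
    by (simp add: partial_def)
qed

lemma partial_mult:
  assumes "u differentiable_on UNIV" "w differentiable_on UNIV"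
  shows "partial i (\<lambda>x. u x * w x) = (\<lambda>x. u x * partial i w x + partial i u x * w x)"
proof
  fix x
  note d = differentiable_has_frechet[OF assms(1), of x] differentiable_has_frechet[OF assms(2), of x]
  have "((\<lambda>x. u x * w x) has_derivative
      (\<lambda>h. u x * frechet_derivative w (at x) h + frechet_derivative u (at x) h * w x)) (at x)"
    using d by (auto intro!: derivative_eq_intros)
  from has_derivative_partials(1)[OF this]
  show "partial i (\<lambda>x. u x * w x) x = u x * partial i w x + partial i u x * w x"
    by (simp add: partial_def)
qed

lemma C2_linear_combination:
  assumes "C2 u" "C2 w"
  shows "C2 (\<lambda>x. a * u x + b * w x)"
  using assms unfolding C2_def
  by (auto simp: partial_linear_combination intro!: derivative_intros continuous_intros)

lemma C2_continuous:
  assumes "C2 u"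
  shows "continuous_on UNIV u" "continuous_on UNIV (partial i u)" "continuous_on UNIV (partial j (partial i u))"
  using assms unfolding C2_def by (auto intro: differentiable_imp_continuous_on)

lemma inner_grad: "grad u x \<bullet> grad w x = (\<Sum>i\<in>UNIV. partial i u x * partial i w x)"
  by (simp add: grad_def inner_vec_def)

text \<open>
  The integrand of the difference of the two sides is the divergence of \<open>w grad u\<close>, and the integral over the
  cell of each partial derivative of a periodic function vanishes.
\<close>

lemma periodic_green_identity:
  assumes indep: "p \<noteq> q" "independent {p, q}"
    and "C2 u" "periodic p q u" "C2 w" "periodic p q w"
  shows "(LBINT x:cell c p q. laplacian u x * w x) = - (LBINT x:cell c p q. grad u x \<bullet> grad w x)"
proof -
  note cont = C2_continuous[OF \<open>C2 u\<close>] C2_continuous[OF \<open>C2 w\<close>]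
  have diff: "partial i u differentiable_on UNIV" "w differentiable_on UNIV" for i
    using assms by (auto simp: C2_def)
  have "(LBINT x:cell c p q. partial i u x * partial i w x + partial i (partial i u) x * w x) = 0" for i
  proof -
    have "(LBINT x:cell c p q. partial i (\<lambda>x. partial i u x * w x) x) = 0"
    proof (rule cell_integral_partial_eq_0[OF indep])
      show "(\<lambda>x. partial i u x * w x) differentiable_on UNIV"
        using diff by (intro differentiable_on_mult) auto
      show "continuous_on UNIV (partial j (\<lambda>x. partial i u x * w x))" for j
        unfolding partial_mult[OF diff] by (intro continuous_intros cont)
      have "periodic p q (partial i u)"
        using assms by (intro periodic_partial) (auto simp: C2_def)
      with assms show "periodic p q (\<lambda>x. partial i u x * w x)"
        by (simp add: periodic_def)
    qed
    then show ?thesis unfolding partial_mult[OF diff] .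
  qed
  then have "0 = (\<Sum>i\<in>UNIV. LBINT x:cell c p q. partial i u x * partial i w x + partial i (partial i u) x * w x)"
    by simp
  also have "\<dots> = (LBINT x:cell c p q. \<Sum>i\<in>UNIV. partial i u x * partial i w x + partial i (partial i u) x * w x)"
    unfolding sum_2 by (intro set_integral_add(2)[symmetric] cell_set_integrable continuous_intros cont)
  also have "\<dots> = (LBINT x:cell c p q. grad u x \<bullet> grad w x + laplacian u x * w x)"
    by (simp add: inner_grad laplacian_def sum.distrib sum_distrib_right)
  also have "\<dots> = (LBINT x:cell c p q. grad u x \<bullet> grad w x) + (LBINT x:cell c p q. laplacian u x * w x)"
    unfolding inner_grad laplacian_def
    by (intro set_integral_add cell_set_integrable continuous_intros cont)
  finally show ?thesis by simp
qed

text \<open>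
  The discretisation of \<open>f\<close> is chosen such that its product with the increment of \<open>\<phi>\<close> is pointwise the increment
  of the double-well potential \<open>W\<close>. For the Laplacian of the midpoint value, Green's identity gives
  \<open>(grad u + grad w)/2 \<bullet> (grad u - grad w)\<close>, which is half the difference of the squared gradients.
\<close>

lemma energy_difference:
  assumes indep: "p \<noteq> q" "independent {p, q}"
    and 1: "C2 (\<phi> n)" "periodic p q (\<phi> n)" and 0: "C2 (\<phi> (n - 1))" "periodic p q (\<phi> (n - 1))"
  shows "(LBINT x:cell c p q. mu_mid \<epsilon> \<phi> n x * (\<phi> n x - \<phi> (n - 1) x))
       = energy (cell c p q) \<epsilon> (\<phi> n) - energy (cell c p q) \<epsilon> (\<phi> (n - 1))"
proof -
  let ?\<Omega> = "cell c p q"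
  define u w where "u = \<phi> n" and "w = \<phi> (n - 1)"
  define m d where "m = midpoint_val \<phi> n" and "d x = u x - w x" for x
  have m: "m = (\<lambda>x. 1/2 * u x + 1/2 * w x)" and d: "d = (\<lambda>x. 1 * u x + (-1) * w x)"
    by (auto simp: m_def d_def u_def w_def midpoint_val_def fun_eq_iff field_simps)
  have C: "C2 u" "C2 w" "periodic p q u" "periodic p q w" using 1 0 by (auto simp: u_def w_def)
  have diff: "u differentiable_on UNIV" "w differentiable_on UNIV" using C by (auto simp: C2_def)
  have C': "C2 m" "C2 d" "periodic p q m" "periodic p q d"
    unfolding m d using C C2_linear_combination[OF C(1,2)] by (auto simp only: periodic_def)
  note cont = C2_continuous[OF C(1)] C2_continuous[OF C(2)] C2_continuous[OF C'(1)] C2_continuous[OF C'(2)]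
  define W where "W u x = 1 / 4 * ((u x)\<^sup>2 - 1)\<^sup>2" for u :: "real^2 \<Rightarrow> real" and x
  have f: "f_mid \<phi> n x * d x = W u x - W w x" for x
    unfolding f_mid_def midpoint_val_def W_def d_def u_def[symmetric] w_def[symmetric]
    by (simp add: field_simps power2_eq_square)
  have grad: "grad m x \<bullet> grad d x = 1 / 2 * (norm (grad u x))\<^sup>2 - 1 / 2 * (norm (grad w x))\<^sup>2" for x
    unfolding power2_norm_eq_inner inner_grad unfolding m d partial_linear_combination[OF diff]
    by (simp add: sum_2 field_simps)
  have gradn: "(norm (grad u x))\<^sup>2 = (\<Sum>i\<in>UNIV. partial i u x * partial i u x)" for u x
    by (simp add: power2_norm_eq_inner inner_grad)
  have contW: "continuous_on UNIV (W u)" "continuous_on UNIV (W w)"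
    unfolding W_def by (intro continuous_intros cont)+
  have contG: "continuous_on UNIV (\<lambda>x. (norm (grad u x))\<^sup>2)" "continuous_on UNIV (\<lambda>x. (norm (grad w x))\<^sup>2)"
    unfolding gradn by (intro continuous_intros cont)+
  have contL: "continuous_on UNIV (\<lambda>x. laplacian m x * d x)"
    unfolding laplacian_def by (intro continuous_intros cont)
  have contI: "continuous_on UNIV (\<lambda>x. grad m x \<bullet> grad d x)"
    unfolding inner_grad by (intro continuous_intros cont)
  have "(LBINT x:?\<Omega>. mu_mid \<epsilon> \<phi> n x * d x) = (LBINT x:?\<Omega>. (W u x - W w x) - \<epsilon>\<^sup>2 * (laplacian m x * d x))"
    by (simp add: mu_mid_def f[symmetric] algebra_simps flip: m_def)
  also have "\<dots> = (LBINT x:?\<Omega>. W u x - W w x) - \<epsilon>\<^sup>2 * (LBINT x:?\<Omega>. laplacian m x * d x)"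
    by (subst set_integral_diff) (auto intro!: cell_set_integrable continuous_intros contW contL)
  also have "\<dots> = (LBINT x:?\<Omega>. W u x - W w x) + \<epsilon>\<^sup>2 * (LBINT x:?\<Omega>. grad m x \<bullet> grad d x)"
    using periodic_green_identity[OF indep C'(1,3,2,4), of c] by simp
  also have "\<dots> = (LBINT x:?\<Omega>. (W u x - W w x) + \<epsilon>\<^sup>2 * (grad m x \<bullet> grad d x))"
    by (subst set_integral_add) (auto intro!: cell_set_integrable continuous_intros contW contI)
  also have "\<dots> = (LBINT x:?\<Omega>. (\<epsilon>\<^sup>2 / 2 * (norm (grad u x))\<^sup>2 + W u x) - (\<epsilon>\<^sup>2 / 2 * (norm (grad w x))\<^sup>2 + W w x))"
    by (simp add: grad algebra_simps)
  also have "\<dots> = energy ?\<Omega> \<epsilon> u - energy ?\<Omega> \<epsilon> w"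
    unfolding energy_def W_def[symmetric]
    by (intro set_integral_diff cell_set_integrable continuous_intros contW contG)
  finally show ?thesis by (simp add: d_def u_def w_def)
qed

section \<open>The energy dissipation law\<close>

lemma v_seq_0: "v_seq \<alpha> t \<phi> 0 x = 0"
  by (simp add: v_seq_def)

text \<open>
  The left-hand side of the scheme is \<open>v\<^sup>n\<close> with half of the doubled diagonal term removed, that is
  \<open>v n - a n n / 2 * d\<close> with \<open>d = \<phi> n x - \<phi> (n - 1) x\<close>. Twice its product with \<open>d\<close> is the right-hand side of
  \<open>rcc_square_identity\<close>, because the DOC kernels recover \<open>d\<close> from \<open>v\<close>.
\<close>

lemma pointwise_dissipation_identity:
  assumes "0 < \<alpha>" "\<alpha> < 1"
    and mesh: "\<And>i. i \<in> {1..N} \<Longrightarrow> t (i - 1) < t i"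
    and CN: "CN_scheme \<Omega> \<kappa> \<epsilon> \<alpha> t N \<phi>" and "n \<in> {1..N}" "x \<in> \<Omega>"
  defines "a \<equiv> mod_kernel (1 - \<alpha>) t"
    and "v \<equiv> \<lambda>k. v_seq \<alpha> t \<phi> k x"
  shows "(\<Sum>j = 1..n. doc a n j * (v j)\<^sup>2)
       + (\<Sum>j = 1..n - 1. (1 / rcc a n j - 1 / rcc a n (j + 1)) *
            (\<Sum>k = 1..j. rcc a n k * (v k - v (k - 1)))\<^sup>2)
       = - 2 * \<kappa> * (mu_mid \<epsilon> \<phi> n x * (\<phi> n x - \<phi> (n - 1) x))"
proof -
  let ?d = "\<lambda>k. \<phi> k x - \<phi> (k - 1) x"
  have diag: "0 < a k k" if "k \<in> {1..n}" for k
    unfolding a_def using assms that by (intro mod_kernel_diag_pos mesh) auto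
  have decr: "a j k < a (j - 1) k" if "1 \<le> k" "k < j" "j \<le> n" for j k
    unfolding a_def using assms that by (intro mod_kernel_strict_decreasing[of _ N]) auto
  have rcc: "rcc a n j \<noteq> 0" if "j \<in> {1..n}" for j
    using rcc_pos[of n a j] diag decr that by force
  have v: "v j = (\<Sum>l = 1..j. a j l * ?d l)" for j
    by (simp add: v_def v_seq_def a_def)
  have d: "(\<Sum>j = 1..n. doc a n j * v j) = ?d n"
    unfolding v using assms diag by (intro doc_inversion) (auto simp: less_imp_neq[symmetric])
  have "v n - a n n / 2 * ?d n = (\<Sum>k = 1..n. kernel (1 - \<alpha>) t n k * ?d k)"
  proof -
    obtain m where m: "n = Suc m" using assms by (cases n) auto
    have "(\<Sum>l = 1..m. a n l * ?d l) = (\<Sum>l = 1..m. kernel (1 - \<alpha>) t n l * ?d l)"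
      unfolding a_def m by (intro sum.cong) (auto simp: mod_kernel_def)
    moreover have "a n n = 2 * kernel (1 - \<alpha>) t n n"
      by (simp add: a_def mod_kernel_def)
    ultimately show ?thesis by (simp add: v m)
  qed
  also have "\<dots> = - \<kappa> * mu_mid \<epsilon> \<phi> n x"
    using CN assms by (simp add: CN_scheme_def)
  finally have scheme: "v n - a n n / 2 * ?d n = - \<kappa> * mu_mid \<epsilon> \<phi> n x" .
  have "2 * v n * ?d n - a n n * (?d n)\<^sup>2 = 2 * (v n - a n n / 2 * ?d n) * ?d n"
    by (simp add: algebra_simps power2_eq_square)
  also have "\<dots> = - 2 * \<kappa> * (mu_mid \<epsilon> \<phi> n x * ?d n)"
    unfolding scheme by simp
  finally have "2 * v n * ?d n - a n n * (?d n)\<^sup>2 = - 2 * \<kappa> * (mu_mid \<epsilon> \<phi> n x * ?d n)" .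
  moreover have "v 0 = 0" by (simp add: v_def v_seq_0)
  ultimately show ?thesis
    using rcc_square_identity[of n a v] rcc assms d by simp
qed

lemma L2_norm_on_squared: "(L2_norm_on \<Omega> u)\<^sup>2 = (LBINT x:\<Omega>. (u x)\<^sup>2)"
proof -
  have "0 \<le> (LBINT x:\<Omega>. (u x)\<^sup>2)"
    unfolding set_lebesgue_integral_def by (intro Bochner_Integration.integral_nonneg) auto
  then show ?thesis by (simp add: L2_norm_on_def)
qed

lemma cell_integral_weighted_sum:
  fixes f :: "nat \<Rightarrow> real^2 \<Rightarrow> real"
  assumes "\<And>j. j \<in> I \<Longrightarrow> continuous_on UNIV (f j)"
  shows "(LBINT x:cell c p q. \<Sum>j\<in>I. b j * f j x) = (\<Sum>j\<in>I. b j * (LBINT x:cell c p q. f j x))"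
  using assms
proof (induction I rule: infinite_finite_induct)
  case (insert i I)
  have "continuous_on UNIV (\<lambda>x. b i * f i x)" "continuous_on UNIV (\<lambda>x. \<Sum>j\<in>I. b j * f j x)"
    using insert by (auto intro!: continuous_intros)
  then show ?case
    using insert by (simp add: set_integral_add cell_set_integrable)
qed (simp_all add: set_lebesgue_integral_def)

text \<open>
  The DCC kernels are column sums of the DOC kernels, so passing from \<open>n - 1\<close> to \<open>n\<close> adds row \<open>n\<close>
  of the DOC kernels.
\<close>

lemma dcc_step:
  assumes "1 \<le> n"
  shows "(\<Sum>j = 1..n. dcc a n j * w j) - (\<Sum>j = 1..n - 1. dcc a (n - 1) j * w j)
       = (\<Sum>j = 1..n. doc a n j * w j)"
proof -
  obtain m where n: "n = Suc m" using assms by (cases n) auto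
  have dcc: "dcc a n j = dcc a m j + doc a n j" if "j \<in> {1..n}" for j
    using that unfolding n dcc_def by (cases "j = Suc m") auto
  have "(\<Sum>j = 1..n. dcc a n j * w j) = (\<Sum>j = 1..n. dcc a m j * w j) + (\<Sum>j = 1..n. doc a n j * w j)"
    unfolding sum.distrib[symmetric] by (intro sum.cong refl) (simp add: dcc distrib_right)
  moreover have "dcc a m n = 0" by (simp add: dcc_def n)
  ultimately show ?thesis by (simp add: n)
qed

theorem theorem3p1:
  fixes \<alpha> \<beta> \<kappa> \<epsilon> T :: real
    and t :: "nat \<Rightarrow> real"
    and N :: nat
    and c p q :: "real^2"
    and \<Omega> :: "(real^2) set"
    and \<phi> :: "nat \<Rightarrow> real^2 \<Rightarrow> real"
  assumes "0 < \<alpha>" and "\<alpha> < 1" and "\<kappa> > 0" and "\<epsilon> > 0"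
    and "\<beta> = 1 - \<alpha>"
    and "t 0 = 0" and "t N = T" and "\<forall>k\<in>{1..N}. t (k - 1) < t k"
    and "\<forall>k. 2 \<le> k \<and> k + 1 \<le> N \<longrightarrow>
           step_ratio t (k + 1) \<ge> ratio_bound \<beta> (step_ratio t k)"
    and "p \<noteq> q" and "independent {p, q}" and "\<Omega> = cell c p q"
    and "\<forall>n\<le>N. C2 (\<phi> n) \<and> periodic p q (\<phi> n)"
    and "CN_scheme \<Omega> \<kappa> \<epsilon> \<alpha> t N \<phi>"
  shows "\<forall>n\<in>{1..N}.
    (mod_energy \<Omega> \<kappa> \<epsilon> \<alpha> t \<phi> n - mod_energy \<Omega> \<kappa> \<epsilon> \<alpha> t \<phi> (n - 1)) / step t n
    + 1 / (2 * \<kappa> * step t n) *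
      (\<Sum>j = 1..n - 1.
         (1 / rcc (mod_kernel (1 - \<alpha>) t) n j - 1 / rcc (mod_kernel (1 - \<alpha>) t) n (j + 1)) *
         (L2_norm_on \<Omega> (\<lambda>x. \<Sum>k = 1..j. rcc (mod_kernel (1 - \<alpha>) t) n k *
            (v_seq \<alpha> t \<phi> k x - v_seq \<alpha> t \<phi> (k - 1) x)))\<^sup>2)
    = 0"
proof
  fix n assume n: "n \<in> {1..N}"
  let ?a = "mod_kernel (1 - \<alpha>) t"
  define v where "v = v_seq \<alpha> t \<phi>"
  define S where "S j x = (\<Sum>k = 1..j. rcc ?a n k * (v k x - v (k - 1) x))" for j x
  define b where "b j = 1 / rcc ?a n j - 1 / rcc ?a n (j + 1)" for j
  have contv: "continuous_on UNIV (v j)" if "j \<le> n" for j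
    unfolding v_def v_seq_def using assms(13) n that
    by (intro continuous_intros C2_continuous(1)) auto
  have cont: "continuous_on UNIV (\<lambda>x. (v j x)\<^sup>2)" "continuous_on UNIV (\<lambda>x. (S j x)\<^sup>2)" if "j \<le> n" for j
    unfolding S_def using that by (auto intro!: continuous_intros contv)
  have "(\<Sum>j = 1..n. doc ?a n j * (L2_norm_on \<Omega> (v j))\<^sup>2) + (\<Sum>j = 1..n - 1. b j * (L2_norm_on \<Omega> (S j))\<^sup>2)
      = (LBINT x:\<Omega>. \<Sum>j = 1..n. doc ?a n j * (v j x)\<^sup>2) + (LBINT x:\<Omega>. \<Sum>j = 1..n - 1. b j * (S j x)\<^sup>2)"
    unfolding L2_norm_on_squared \<open>\<Omega> = cell c p q\<close>
    by (intro arg_cong2[where f="(+)"] cell_integral_weighted_sum[symmetric] cont) auto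
  also have "\<dots> = (LBINT x:\<Omega>. (\<Sum>j = 1..n. doc ?a n j * (v j x)\<^sup>2) + (\<Sum>j = 1..n - 1. b j * (S j x)\<^sup>2))"
    unfolding \<open>\<Omega> = cell c p q\<close>
    by (intro set_integral_add(2)[symmetric] cell_set_integrable continuous_on_sum
        continuous_on_mult continuous_on_const cont) auto
  also have "\<dots> = (LBINT x:\<Omega>. - 2 * \<kappa> * (mu_mid \<epsilon> \<phi> n x * (\<phi> n x - \<phi> (n - 1) x)))"
  proof (rule set_lebesgue_integral_cong)
    show "\<Omega> \<in> sets lborel"
      unfolding \<open>\<Omega> = cell c p q\<close> using compact_cell by (simp add: borel_compact)
    show "\<forall>x. x \<in> \<Omega> \<longrightarrow> (\<Sum>j = 1..n. doc ?a n j * (v j x)\<^sup>2) + (\<Sum>j = 1..n - 1. b j * (S j x)\<^sup>2)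
        = - 2 * \<kappa> * (mu_mid \<epsilon> \<phi> n x * (\<phi> n x - \<phi> (n - 1) x))"
      unfolding v_def S_def b_def
      using pointwise_dissipation_identity[OF assms(1,2) _ assms(14) n] assms(8) by blast
  qed
  also have "\<dots> = - 2 * \<kappa> * (energy \<Omega> \<epsilon> (\<phi> n) - energy \<Omega> \<epsilon> (\<phi> (n - 1)))"
  proof -
    have "n \<le> N" "n - 1 \<le> N" using n by auto
    then have "(LBINT x:\<Omega>. mu_mid \<epsilon> \<phi> n x * (\<phi> n x - \<phi> (n - 1) x))
        = energy \<Omega> \<epsilon> (\<phi> n) - energy \<Omega> \<epsilon> (\<phi> (n - 1))"
      unfolding \<open>\<Omega> = cell c p q\<close> using assms(13) by (intro energy_difference[OF assms(10,11)]) auto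
    then show ?thesis by (simp only: set_integral_mult_right)
  qed
  finally have key: "(\<Sum>j = 1..n. doc ?a n j * (L2_norm_on \<Omega> (v j))\<^sup>2) + (\<Sum>j = 1..n - 1. b j * (L2_norm_on \<Omega> (S j))\<^sup>2)
      = - 2 * \<kappa> * (energy \<Omega> \<epsilon> (\<phi> n) - energy \<Omega> \<epsilon> (\<phi> (n - 1)))" .
  have "mod_energy \<Omega> \<kappa> \<epsilon> \<alpha> t \<phi> n - mod_energy \<Omega> \<kappa> \<epsilon> \<alpha> t \<phi> (n - 1)
      = energy \<Omega> \<epsilon> (\<phi> n) - energy \<Omega> \<epsilon> (\<phi> (n - 1))
        + 1 / (2 * \<kappa>) * (\<Sum>j = 1..n. doc ?a n j * (L2_norm_on \<Omega> (v j))\<^sup>2)"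
    using dcc_step[of n ?a "\<lambda>j. (L2_norm_on \<Omega> (v j))\<^sup>2"] n
    by (simp add: mod_energy_def v_def algebra_simps flip: diff_divide_distrib)
  also have "\<dots> = - (1 / (2 * \<kappa>) * (\<Sum>j = 1..n - 1. b j * (L2_norm_on \<Omega> (S j))\<^sup>2))"
  proof -
    have "(\<Sum>j = 1..n. doc ?a n j * (L2_norm_on \<Omega> (v j))\<^sup>2)
        = - 2 * \<kappa> * (energy \<Omega> \<epsilon> (\<phi> n) - energy \<Omega> \<epsilon> (\<phi> (n - 1)))
          - (\<Sum>j = 1..n - 1. b j * (L2_norm_on \<Omega> (S j))\<^sup>2)"
      using key by (simp only: eq_diff_eq)
    then show ?thesis
      using \<open>\<kappa> > 0\<close> by (simp only: right_diff_distrib) (simp add: field_simps)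
  qed
  finally have "(mod_energy \<Omega> \<kappa> \<epsilon> \<alpha> t \<phi> n - mod_energy \<Omega> \<kappa> \<epsilon> \<alpha> t \<phi> (n - 1)) / step t n
    + 1 / (2 * \<kappa> * step t n) * (\<Sum>j = 1..n - 1. b j * (L2_norm_on \<Omega> (S j))\<^sup>2) = 0"
    using \<open>\<kappa> > 0\<close> by (simp add: divide_simps)
  moreover have "(\<lambda>x. \<Sum>k = 1..j. rcc ?a n k * (v k x - v (k - 1) x)) = S j" for j
    by (simp add: S_def fun_eq_iff)
  ultimately show "(mod_energy \<Omega> \<kappa> \<epsilon> \<alpha> t \<phi> n - mod_energy \<Omega> \<kappa> \<epsilon> \<alpha> t \<phi> (n - 1)) / step t n
    + 1 / (2 * \<kappa> * step t n) *
      (\<Sum>j = 1..n - 1.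
         (1 / rcc (mod_kernel (1 - \<alpha>) t) n j - 1 / rcc (mod_kernel (1 - \<alpha>) t) n (j + 1)) *
         (L2_norm_on \<Omega> (\<lambda>x. \<Sum>k = 1..j. rcc (mod_kernel (1 - \<alpha>) t) n k *
            (v_seq \<alpha> t \<phi> k x - v_seq \<alpha> t \<phi> (k - 1) x)))\<^sup>2)
    = 0"
    by (simp add: b_def v_def)
qed

end
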